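(* For every feasible instance of the Central Production Vehicle Routing Problem (CP-VRP), there exists an optimal solution in which the production schedule of each machine finishes all jobs (assigned to that machine) delivered by one route before switching to producing jobs that are to be delivered by a different route; that is, in the schedule of each machine, the jobs of customers served by the same route occupy consecutive positions.
   Context: **CP-VRP instance.** A graph with node set $V=\{0\}\cup C$, where $0$ is the depot and $C=\{1,\dots,n\}$ is the set of customers, and edge set $E$; each edge $(i,j)\in E$ has a distance $c_{ij}\ge 0$ and a travel time $t_{ij}\ge 0$. There is a set $K=\{1,\dots,\kappa\}$ of identical vehicles, each of capacity $Q$, and a set $M'=\{1,\dots,m'\}$ of identical machines located at the depot. Each customer $i\in C$ has a demand $d_i\ge 0$, a production time $p_i\ge 0$, a service time $e_i\ge 0$, and a time window $[a_i,b_i]$ whose start $a_i$ is strict and whose end $b_i$ is soft. There is a latest return time $D$, an early production parameter $H\ge 0$, and weights $\omega_1,\omega_2\ge 0$. **Solution.** A solution consists of: (i) for each vehicle, one route (a possibly empty ordered list of customers, starting from and ending at the depot along edges of $E$), such that each customer lies on exactly one route and the total demand of the customers on each route is at most $Q$; (ii) a production schedule: each customer's order (job) is assigned to exactly one machine, and each machine has a sequence in which its jobs are produced. Each machine processes one job at a time, without interruption, consecutively from time $-H$, customer $i$'s job taking time $p_i$. **Timing.** Each vehicle departs from the depot at the maximum of $0$ and the latest completion time of the orders of the customers on its route. The service start time $s_i$ at customer $i$ is the maximum of the vehicle's arrival time at $i$ and $a_i$; the vehicle leaves $i$ at time $s_i+e_i$. The solution is feasible if every vehicle returns to the depot no later than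 $D$. An instance is feasible if it has a feasible solution. **Objective.** The delay at customer $i$ is $y_i=\max\{0,s_i-b_i\}$. The objective, to be minimized over feasible solutions, is $\omega_1\cdot(\text{total distance } c \text{ of all routes})+\omega_2\sum_{i\in C}y_i$. An optimal solution is a feasible solution attaining the minimum. *)

theory Defs
  imports Complex_Main
begin

text \<open>
  Nodes are natural numbers: \<open>0\<close> is the depot, \<open>1, \<dots>, n\<close> are the customers. Edges are ordered
  pairs; an undirected graph is the case of symmetric \<open>edges\<close>, \<open>travel_dist\<close> and \<open>travel_time\<close>.
\<close>

record instance_data =
  num_customers :: nat
  edges :: "(nat \<times> nat) set"
  travel_dist :: "nat \<Rightarrow> nat \<Rightarrow> real"
  travel_time :: "nat \<Rightarrow> nat \<Rightarrow> real"
  num_vehicles :: nat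
  capacity :: real
  num_machines :: nat
  demand :: "nat \<Rightarrow> real"
  prod_time :: "nat \<Rightarrow> real"
  serv_time :: "nat \<Rightarrow> real"
  win_start :: "nat \<Rightarrow> real"
  win_end :: "nat \<Rightarrow> real"
  latest_return :: real
  early_prod :: real
  weight_dist :: real
  weight_delay :: real

definition customers :: "instance_data \<Rightarrow> nat set" where
  "customers I = {1..num_customers I}"

definition nodes :: "instance_data \<Rightarrow> nat set" where
  "nodes I = {0} \<union> customers I"

definition vehicles :: "instance_data \<Rightarrow> nat set" where
  "vehicles I = {1..num_vehicles I}"

definition machines :: "instance_data \<Rightarrow> nat set" where
  "machines I = {1..num_machines I}"

definition cpvrp_instance :: "instance_data \<Rightarrow> bool" where
  "cpvrp_instance I \<longleftrightarrow>
     edges I \<subseteq> nodes I \<times> nodes I \<and>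
     (\<forall>(i, j)\<in>edges I. travel_dist I i j \<ge> 0 \<and> travel_time I i j \<ge> 0) \<and>
     (\<forall>i\<in>customers I. demand I i \<ge> 0 \<and> prod_time I i \<ge> 0 \<and> serv_time I i \<ge> 0) \<and>
     early_prod I \<ge> 0 \<and> weight_dist I \<ge> 0 \<and> weight_delay I \<ge> 0"

text \<open>
  A route lists its customers in visiting order, without the depot; a machine sequence lists the
  customers whose jobs it produces, in production order. Values at indices that are not
  vehicles (machines) of the instance are irrelevant.
\<close>

record solution =
  route :: "nat \<Rightarrow> nat list"
  sched :: "nat \<Rightarrow> nat list"

text \<open>The vehicle of an empty route stays at the depot and traverses no edge.\<close>

definition route_legs :: "nat list \<Rightarrow> (nat \<times> nat) list" where
  "route_legs r = (if r = [] then [] else zip (0 # r) (r @ [0]))"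

definition is_solution :: "instance_data \<Rightarrow> solution \<Rightarrow> bool" where
  "is_solution I S \<longleftrightarrow>
     (\<forall>k\<in>vehicles I.
        distinct (route S k) \<and> set (route S k) \<subseteq> customers I \<and>
        set (route_legs (route S k)) \<subseteq> edges I \<and>
        (\<Sum>i\<leftarrow>route S k. demand I i) \<le> capacity I) \<and>
     (\<forall>i\<in>customers I. \<exists>!k. k \<in> vehicles I \<and> i \<in> set (route S k)) \<and>
     (\<forall>m\<in>machines I. distinct (sched S m) \<and> set (sched S m) \<subseteq> customers I) \<and>
     (\<forall>i\<in>customers I. \<exists>!m. m \<in> machines I \<and> i \<in> set (sched S m))"

definition vehicle_of :: "instance_data \<Rightarrow> solution \<Rightarrow> nat \<Rightarrow> nat" where
  "vehicle_of I S i = (THE k. k \<in> vehicles I \<and> i \<in> set (route S k))"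

definition machine_of :: "instance_data \<Rightarrow> solution \<Rightarrow> nat \<Rightarrow> nat" where
  "machine_of I S i = (THE m. m \<in> machines I \<and> i \<in> set (sched S m))"

definition completion_time :: "instance_data \<Rightarrow> solution \<Rightarrow> nat \<Rightarrow> real" where
  "completion_time I S i =
     - early_prod I
     + (\<Sum>j\<leftarrow>takeWhile (\<lambda>j. j \<noteq> i) (sched S (machine_of I S i)). prod_time I j)
     + prod_time I i"

definition departure_time :: "instance_data \<Rightarrow> solution \<Rightarrow> nat \<Rightarrow> real" where
  "departure_time I S k = Max (insert 0 (completion_time I S ` set (route S k)))"

text \<open>
  In the next two functions the vehicle leaves node \<open>u\<close> at time \<open>\<tau>\<close>, with the customers in the
  list argument still to be visited.
\<close>

fun service_start_from :: "instance_data \<Rightarrow> nat \<Rightarrow> real \<Rightarrow> nat list \<Rightarrow> nat \<Rightarrow> real" where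
  "service_start_from I u \<tau> [] i = undefined"
| "service_start_from I u \<tau> (v # r) i =
     (let s = max (\<tau> + travel_time I u v) (win_start I v)
      in if i = v then s else service_start_from I v (s + serv_time I v) r i)"

fun return_from :: "instance_data \<Rightarrow> nat \<Rightarrow> real \<Rightarrow> nat list \<Rightarrow> real" where
  "return_from I u \<tau> [] = \<tau> + travel_time I u 0"
| "return_from I u \<tau> (v # r) =
     (let s = max (\<tau> + travel_time I u v) (win_start I v)
      in return_from I v (s + serv_time I v) r)"

definition service_start :: "instance_data \<Rightarrow> solution \<Rightarrow> nat \<Rightarrow> real" where
  "service_start I S i =
     (let k = vehicle_of I S i
      in service_start_from I 0 (departure_time I S k) (route S k) i)"

definition return_time :: "instance_data \<Rightarrow> solution \<Rightarrow> nat \<Rightarrow> real" where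
  "return_time I S k =
     (if route S k = [] then departure_time I S k
      else return_from I 0 (departure_time I S k) (route S k))"

definition feasible :: "instance_data \<Rightarrow> solution \<Rightarrow> bool" where
  "feasible I S \<longleftrightarrow> is_solution I S \<and> (\<forall>k\<in>vehicles I. return_time I S k \<le> latest_return I)"

definition feasible_instance :: "instance_data \<Rightarrow> bool" where
  "feasible_instance I \<longleftrightarrow> (\<exists>S. feasible I S)"

definition delay :: "instance_data \<Rightarrow> solution \<Rightarrow> nat \<Rightarrow> real" where
  "delay I S i = max 0 (service_start I S i - win_end I i)"

definition objective :: "instance_data \<Rightarrow> solution \<Rightarrow> real" where
  "objective I S =
     weight_dist I * (\<Sum>k\<in>vehicles I. \<Sum>(i, j)\<leftarrow>route_legs (route S k). travel_dist I i j)
     + weight_delay I * (\<Sum>i\<in>customers I. delay I S i)"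

definition optimal :: "instance_data \<Rightarrow> solution \<Rightarrow> bool" where
  "optimal I S \<longleftrightarrow> feasible I S \<and> (\<forall>S'. feasible I S' \<longrightarrow> objective I S \<le> objective I S')"

definition route_consecutive :: "instance_data \<Rightarrow> solution \<Rightarrow> bool" where
  "route_consecutive I S \<longleftrightarrow>
     (\<forall>m\<in>machines I. \<forall>k\<in>vehicles I. \<exists>l u.
        {q. q < length (sched S m) \<and> sched S m ! q \<in> set (route S k)} = {l..<u})"

end

theory Submission
  imports Defs "HOL-Library.Product_Lexorder"
begin

text \<open>
  The schedule influences feasibility and cost only through the departure times of the vehicles,
  and both the return times and the delays are nondecreasing in them. So it suffices to
  rearrange a given schedule in such a way that the jobs of each route become consecutive on every
  machine and no departure is postponed.

  Let \<open>\<delta> k\<close> be the departure time of vehicle \<open>k\<close> in the given solution, and resequence every machine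
  by increasing \<open>\<delta>\<close> of the delivering vehicle, breaking ties by the vehicle index (\<open>grouped\<close>). The
  jobs of one route are then consecutive because they are precisely those with a given sorting key.
  In the new sequence, only jobs with departure time at most \<open>\<delta> k\<close> precede a job of
  vehicle \<open>k\<close>. In the old sequence, the last job among all jobs of the machine with departure time
  at most \<open>\<delta> k\<close> was completed by time \<open>\<delta> k\<close>, and by then all the others were completed as well. So
  their total production time fits before \<open>\<delta> k\<close>, and the new completion time of every job of vehicle
  \<open>k\<close> is at most \<open>\<delta> k\<close> (\<open>completion_time_grouped_le\<close>).

  Existence of an optimum comes from the same construction: \<open>grouped\<close> also empties the lists at
  indices that belong to no vehicle or machine, so that its values form a finite set. Every
  feasible solution is dominated by a member of that set, and a cheapest feasible member is
  therefore optimal among all solutions.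
\<close>

section \<open>Production times along a sorted sequence\<close>

lemma sum_list_upto_eq_sum:
  fixes p :: "'a \<Rightarrow> real"
  assumes "distinct xs"
  shows "(\<Sum>j\<leftarrow>takeWhile (\<lambda>j. j \<noteq> i) xs. p j) + p i
    = sum p (insert i (set (takeWhile (\<lambda>j. j \<noteq> i) xs)))"
proof -
  have "i \<notin> set (takeWhile (\<lambda>j. j \<noteq> i) xs)"
    by (auto dest: set_takeWhileD)
  then show ?thesis
    using assms by (simp add: sum_list_distinct_conv_sum_set)
qed

lemma takeWhile_sort_key_le:
  assumes "i \<in> set xs" "j \<in> set (takeWhile (\<lambda>j. j \<noteq> i) (sort_key f xs))"
  shows "f j \<le> f i"
proof -
  obtain as bs where ys: "sort_key f xs = as @ i # bs" "i \<notin> set as"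
    using split_list_first[of i "sort_key f xs"] assms(1) by auto
  have "takeWhile (\<lambda>j. j \<noteq> i) (sort_key f xs) = as"
    unfolding ys(1) using ys(2) by (subst takeWhile_append2) auto
  moreover have "sorted (map f (as @ i # bs))"
    using sorted_sort_key[of f xs] by (simp only: ys(1))
  ultimately show ?thesis
    using assms(2) by (simp add: sorted_append)
qed

lemma sum_list_upto_sort_key_le:
  fixes p :: "'a \<Rightarrow> real"
  assumes "distinct xs" "i \<in> set xs" "\<And>j. j \<in> set xs \<Longrightarrow> p j \<ge> 0"
  shows "(\<Sum>j\<leftarrow>takeWhile (\<lambda>j. j \<noteq> i) (sort_key f xs). p j) + p i
    \<le> sum p {j \<in> set xs. f j \<le> f i}"
proof -
  have "insert i (set (takeWhile (\<lambda>j. j \<noteq> i) (sort_key f xs))) \<subseteq> {j \<in> set xs. f j \<le> f i}"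
    using assms(2) takeWhile_sort_key_le[OF assms(2)] by (auto dest: set_takeWhileD)
  moreover have "distinct (sort_key f xs)"
    using assms(1) by simp
  ultimately show ?thesis
    using assms(3) by (auto simp: sum_list_upto_eq_sum intro!: sum_mono2)
qed

text \<open>
  When the last member of a set of jobs is finished, all its members have been produced.
\<close>

lemma sum_le_sum_list_upto_last:
  fixes p :: "'a \<Rightarrow> real"
  assumes "distinct xs" "\<exists>j\<in>set xs. P j" "\<And>j. j \<in> set xs \<Longrightarrow> p j \<ge> 0"
  obtains i where "i \<in> set xs" "P i"
    "sum p {j \<in> set xs. P j} \<le> (\<Sum>j\<leftarrow>takeWhile (\<lambda>j. j \<noteq> i) xs. p j) + p i"
proof -
  obtain as i bs where xs: "xs = as @ i # bs" and i: "P i" and bs: "\<forall>j\<in>set bs. \<not> P j"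
    using split_list_last_prop[OF assms(2)] by blast
  have "takeWhile (\<lambda>j. j \<noteq> i) xs = as"
    using assms(1) unfolding xs by (subst takeWhile_append2) auto
  moreover have "sum p {j \<in> set xs. P j} \<le> sum p (insert i (set as))"
    using assms(3) bs by (intro sum_mono2) (auto simp: xs)
  ultimately show thesis
    using that[of i] i sum_list_upto_eq_sum[OF assms(1), of p i] by (simp add: xs)
qed

lemma convex_nat_set_eq_interval:
  fixes A :: "nat set"
  assumes "finite A" "\<And>a b c. a \<in> A \<Longrightarrow> c \<in> A \<Longrightarrow> a \<le> b \<Longrightarrow> b \<le> c \<Longrightarrow> b \<in> A"
  shows "\<exists>l u. A = {l..<u}"
proof (cases "A = {}")
  case True
  then have "A = {0..<0}" by simp
  then show ?thesis by blast
next
  case False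
  have "A = {Min A..<Suc (Max A)}"
  proof
    show "A \<subseteq> {Min A..<Suc (Max A)}"
      using assms(1) by (auto simp: less_Suc_eq_le)
    show "{Min A..<Suc (Max A)} \<subseteq> A"
      using assms(2)[OF Min_in[OF assms(1) False] Max_in[OF assms(1) False]]
      by (auto simp: less_Suc_eq_le)
  qed
  then show ?thesis by blast
qed

lemma key_positions_sort_key_interval:
  "\<exists>l u. {q. q < length (sort_key f xs) \<and> f (sort_key f xs ! q) = c} = {l..<u}"
proof (rule convex_nat_set_eq_interval)
  have mono: "f (sort_key f xs ! a) \<le> f (sort_key f xs ! b)"
    if "a \<le> b" "b < length (sort_key f xs)" for a b
    using sorted_nth_mono[OF sorted_sort_key[of f xs] that(1)] that by simp
  fix a b c'
  assume "a \<in> {q. q < length (sort_key f xs) \<and> f (sort_key f xs ! q) = c}"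
    and "c' \<in> {q. q < length (sort_key f xs) \<and> f (sort_key f xs ! q) = c}"
    and "a \<le> b" "b \<le> c'"
  then show "b \<in> {q. q < length (sort_key f xs) \<and> f (sort_key f xs ! q) = c}"
    using mono[of a b] mono[of b c'] by auto
qed simp

section \<open>Monotonicity in the departure times\<close>

lemma service_start_from_mono:
  assumes "i \<in> set r" "\<tau> \<le> \<tau>'"
  shows "service_start_from I u \<tau> r i \<le> service_start_from I u \<tau>' r i"
  using assms
proof (induction r arbitrary: u \<tau> \<tau>')
  case (Cons v r)
  have "max (\<tau> + travel_time I u v) (win_start I v) \<le> max (\<tau>' + travel_time I u v) (win_start I v)"
    using Cons.prems(2) by (intro max.mono) auto
  then show ?case
    using Cons by (auto simp: Let_def)
qed simp

lemma return_from_mono: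
  "\<tau> \<le> \<tau>' \<Longrightarrow> return_from I u \<tau> r \<le> return_from I u \<tau>' r"
proof (induction r arbitrary: u \<tau> \<tau>')
  case (Cons v r)
  have "max (\<tau> + travel_time I u v) (win_start I v) \<le> max (\<tau>' + travel_time I u v) (win_start I v)"
    using Cons.prems by (intro max.mono) auto
  then show ?case
    using Cons.IH by (simp add: Let_def)
qed simp

lemma vehicle_of_eq:
  assumes "is_solution I S" "k \<in> vehicles I" "i \<in> set (route S k)"
  shows "vehicle_of I S i = k"
proof -
  have "i \<in> customers I"
    using assms unfolding is_solution_def by blast
  then have "\<exists>!k. k \<in> vehicles I \<and> i \<in> set (route S k)"
    using assms(1) unfolding is_solution_def by blast
  then show ?thesis
    unfolding vehicle_of_def by (rule the1_equality) (use assms in blast)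
qed

lemma vehicle_of_in:
  assumes "is_solution I S" "i \<in> customers I"
  shows "vehicle_of I S i \<in> vehicles I" "i \<in> set (route S (vehicle_of I S i))"
proof -
  have "\<exists>!k. k \<in> vehicles I \<and> i \<in> set (route S k)"
    using assms unfolding is_solution_def by blast
  from theI'[OF this] show "vehicle_of I S i \<in> vehicles I" "i \<in> set (route S (vehicle_of I S i))"
    unfolding vehicle_of_def by blast+
qed

lemma machine_of_eq:
  assumes "is_solution I S" "m \<in> machines I" "i \<in> set (sched S m)"
  shows "machine_of I S i = m"
proof -
  have "i \<in> customers I"
    using assms unfolding is_solution_def by blast
  then have "\<exists>!m. m \<in> machines I \<and> i \<in> set (sched S m)"
    using assms(1) unfolding is_solution_def by blast
  then show ?thesis
    unfolding machine_of_def by (rule the1_equality) (use assms in blast)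
qed

lemma machine_of_in:
  assumes "is_solution I S" "i \<in> customers I"
  shows "machine_of I S i \<in> machines I" "i \<in> set (sched S (machine_of I S i))"
proof -
  have "\<exists>!m. m \<in> machines I \<and> i \<in> set (sched S m)"
    using assms unfolding is_solution_def by blast
  from theI'[OF this] show "machine_of I S i \<in> machines I" "i \<in> set (sched S (machine_of I S i))"
    unfolding machine_of_def by blast+
qed

lemma completion_time_le_departure_time:
  "i \<in> set (route S k) \<Longrightarrow> completion_time I S i \<le> departure_time I S k"
  unfolding departure_time_def by (intro Max_ge) auto

lemma departure_time_nonneg: "0 \<le> departure_time I S k"
  unfolding departure_time_def by (intro Max_ge) auto

text \<open>
  Two solutions with the same routes can be compared by their departure times alone.
\<close>

context
  fixes I S S'
  assumes sol: "is_solution I S" "is_solution I S'"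
    and same_routes: "\<And>k. k \<in> vehicles I \<Longrightarrow> route S' k = route S k"
    and earlier: "\<And>k. k \<in> vehicles I \<Longrightarrow> departure_time I S' k \<le> departure_time I S k"
begin

lemma feasible_if_departures_earlier:
  assumes "feasible I S"
  shows "feasible I S'"
proof -
  have "return_time I S' k \<le> return_time I S k" if "k \<in> vehicles I" for k
    using same_routes[OF that] earlier[OF that]
    by (simp add: return_time_def return_from_mono)
  then show ?thesis
    using assms sol unfolding feasible_def by (meson order_trans)
qed

lemma objective_le_if_departures_earlier:
  assumes "weight_delay I \<ge> 0"
  shows "objective I S' \<le> objective I S"
proof -
  have "delay I S' i \<le> delay I S i" if "i \<in> customers I" for i
  proof -
    note veh = vehicle_of_in[OF sol(1) that]
    have "vehicle_of I S' i = vehicle_of I S i"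
      using vehicle_of_eq[OF sol(2) veh(1)] veh same_routes by simp
    then have "service_start I S' i \<le> service_start I S i"
      using veh same_routes earlier by (simp add: service_start_def Let_def service_start_from_mono)
    then show ?thesis
      by (simp add: delay_def)
  qed
  then have "(\<Sum>i\<in>customers I. delay I S' i) \<le> (\<Sum>i\<in>customers I. delay I S i)"
    by (rule sum_mono)
  then show ?thesis
    using assms same_routes by (simp add: objective_def mult_left_mono)
qed

end

section \<open>Resequencing the machines by departure time\<close>

text \<open>
  The vehicle index in the key separates the jobs of vehicles that depart simultaneously.
\<close>

definition group_key :: "instance_data \<Rightarrow> solution \<Rightarrow> nat \<Rightarrow> real \<times> nat" where
  "group_key I S i = (departure_time I S (vehicle_of I S i), vehicle_of I S i)"

text \<open>
  Lists at indices outside the instance are emptied, which makes the range of this function finite.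
\<close>

definition grouped :: "instance_data \<Rightarrow> solution \<Rightarrow> solution" where
  "grouped I S =
     \<lparr>route = (\<lambda>k. if k \<in> vehicles I then route S k else []),
      sched = (\<lambda>m. if m \<in> machines I then sort_key (group_key I S) (sched S m) else [])\<rparr>"

lemma route_grouped: "k \<in> vehicles I \<Longrightarrow> route (grouped I S) k = route S k"
  by (simp add: grouped_def)

lemma sched_grouped:
  "m \<in> machines I \<Longrightarrow> sched (grouped I S) m = sort_key (group_key I S) (sched S m)"
  by (simp add: grouped_def)

lemma is_solution_grouped:
  "is_solution I S \<Longrightarrow> is_solution I (grouped I S)"
  unfolding is_solution_def by (simp add: route_grouped sched_grouped cong: conj_cong)

text \<open>
  Let the job \<open>i\<close> belong to vehicle \<open>k\<close>. The jobs with key at most that of \<open>i\<close> include all jobs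
  produced up to \<open>i\<close> in the new sequence. In the old one, the last of them was completed before its
  own vehicle departed, hence before \<open>k\<close> departed.
\<close>

lemma completion_time_grouped_le:
  assumes inst: "cpvrp_instance I" and sol: "is_solution I S"
    and k: "k \<in> vehicles I" and i: "i \<in> set (route S k)"
  shows "completion_time I (grouped I S) i \<le> departure_time I S k"
proof -
  have cust: "i \<in> customers I"
    using sol k i unfolding is_solution_def by blast
  define m where "m = machine_of I S i"
  have m: "m \<in> machines I" and im: "i \<in> set (sched S m)"
    using machine_of_in[OF sol cust] by (auto simp: m_def)
  have dist: "distinct (sched S m)" and sub: "set (sched S m) \<subseteq> customers I"
    using sol m unfolding is_solution_def by blast+
  have nonneg: "prod_time I j \<ge> 0" if "j \<in> set (sched S m)" for j
    using inst sub that unfolding cpvrp_instance_def by blast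
  let ?f = "group_key I S"
  obtain l where l: "l \<in> set (sched S m)" "?f l \<le> ?f i"
    and last: "sum (prod_time I) {j \<in> set (sched S m). ?f j \<le> ?f i}
      \<le> (\<Sum>j\<leftarrow>takeWhile (\<lambda>j. j \<noteq> l) (sched S m). prod_time I j) + prod_time I l"
    using sum_le_sum_list_upto_last[OF dist, of "\<lambda>j. ?f j \<le> ?f i" "prod_time I"] im nonneg by blast
  have mach: "machine_of I (grouped I S) i = m"
    using machine_of_eq[OF is_solution_grouped[OF sol] m] im m by (simp add: sched_grouped)
  have "completion_time I (grouped I S) i
      = - early_prod I + ((\<Sum>j\<leftarrow>takeWhile (\<lambda>j. j \<noteq> i) (sort_key ?f (sched S m)). prod_time I j)
        + prod_time I i)"
    using m by (simp add: completion_time_def mach sched_grouped)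
  also have "\<dots> \<le> - early_prod I + sum (prod_time I) {j \<in> set (sched S m). ?f j \<le> ?f i}"
    using sum_list_upto_sort_key_le[OF dist im nonneg] by simp
  also have "\<dots> \<le> completion_time I S l"
    using last machine_of_eq[OF sol m l(1)] by (simp add: completion_time_def)
  also have "\<dots> \<le> departure_time I S (vehicle_of I S l)"
    using vehicle_of_in[OF sol] l(1) sub by (intro completion_time_le_departure_time) blast
  also have "\<dots> \<le> departure_time I S (vehicle_of I S i)"
    using l(2) by (auto simp: group_key_def)
  also have "\<dots> = departure_time I S k"
    using vehicle_of_eq[OF sol k i] by simp
  finally show ?thesis .
qed

lemma departure_time_grouped_le:
  assumes "cpvrp_instance I" "is_solution I S" "k \<in> vehicles I"
  shows "departure_time I (grouped I S) k \<le> departure_time I S k"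
proof -
  have "x \<le> departure_time I S k"
    if "x \<in> insert 0 (completion_time I (grouped I S) ` set (route S k))" for x
    using that completion_time_grouped_le[OF assms] departure_time_nonneg by auto
  then show ?thesis
    unfolding departure_time_def[of I "grouped I S" k] route_grouped[OF assms(3)]
    by (intro Max.boundedI) auto
qed

lemma route_consecutive_grouped:
  assumes sol: "is_solution I S"
  shows "route_consecutive I (grouped I S)"
  unfolding route_consecutive_def
proof (intro ballI)
  fix m k
  assume m: "m \<in> machines I" and k: "k \<in> vehicles I"
  let ?ys = "sort_key (group_key I S) (sched S m)"
  have "i \<in> set (route S k) \<longleftrightarrow> group_key I S i = (departure_time I S k, k)"
    if "i \<in> set ?ys" for i
  proof -
    have "i \<in> customers I"
      using that sol m unfolding is_solution_def by auto
    then show ?thesis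
      using vehicle_of_eq[OF sol k] vehicle_of_in[OF sol] by (auto simp: group_key_def)
  qed
  then have "{q. q < length ?ys \<and> ?ys ! q \<in> set (route S k)}
      = {q. q < length ?ys \<and> group_key I S (?ys ! q) = (departure_time I S k, k)}"
    using nth_mem[of _ ?ys] by blast
  then show "\<exists>l u. {q. q < length (sched (grouped I S) m) \<and>
      sched (grouped I S) m ! q \<in> set (route (grouped I S) k)} = {l..<u}"
    unfolding sched_grouped[OF m] route_grouped[OF k]
    by (simp only: key_positions_sort_key_interval)
qed

lemma finite_grouped_solutions: "finite (grouped I ` {S. is_solution I S})"
proof -
  let ?L = "{xs. set xs \<subseteq> customers I \<and> distinct xs}"
  let ?F = "\<lambda>A. {f. \<forall>x. (x \<in> A \<longrightarrow> f x \<in> ?L) \<and> (x \<notin> A \<longrightarrow> f x = [])}"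
  have L: "finite ?L"
    by (rule finite_subset_distinct) (simp add: customers_def)
  have "finite (?F (vehicles I))" "finite (?F (machines I))"
    by (rule finite_set_of_finite_funs[OF _ L]; simp add: vehicles_def machines_def)+
  then have "finite ((\<lambda>(r, s). \<lparr>route = r, sched = s\<rparr>) ` (?F (vehicles I) \<times> ?F (machines I)))"
    by blast
  moreover have "grouped I S
      \<in> (\<lambda>(r, s). \<lparr>route = r, sched = s\<rparr>) ` (?F (vehicles I) \<times> ?F (machines I))"
    if "is_solution I S" for S
  proof (rule image_eqI)
    show "grouped I S = (\<lambda>(r, s). \<lparr>route = r, sched = s\<rparr>)
        (route (grouped I S), sched (grouped I S))"
      by simp
    show "(route (grouped I S), sched (grouped I S)) \<in> ?F (vehicles I) \<times> ?F (machines I)"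
      using is_solution_grouped[OF that] by (simp add: is_solution_def) (simp add: grouped_def)
  qed
  then have "grouped I ` {S. is_solution I S}
      \<subseteq> (\<lambda>(r, s). \<lparr>route = r, sched = s\<rparr>) ` (?F (vehicles I) \<times> ?F (machines I))"
    by blast
  ultimately show ?thesis
    by (rule finite_subset[rotated])
qed

theorem proposition3:
  fixes I :: instance_data
  assumes "cpvrp_instance I" and "feasible_instance I"
  shows "\<exists>S. optimal I S \<and> route_consecutive I S"
proof -
  let ?T = "grouped I ` {S. feasible I S}"
  have sol: "is_solution I S" if "feasible I S" for S
    using that by (simp add: feasible_def)
  have feas: "feasible I (grouped I S)" if "feasible I S" for S
    by (rule feasible_if_departures_earlier[OF sol[OF that] is_solution_grouped[OF sol[OF that]]
          route_grouped departure_time_grouped_le[OF assms(1) sol[OF that]] that])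
  have weight_nonneg: "weight_delay I \<ge> 0"
    using assms(1) unfolding cpvrp_instance_def by blast
  have cost: "objective I (grouped I S) \<le> objective I S" if "feasible I S" for S
    by (rule objective_le_if_departures_earlier[OF sol[OF that]
          is_solution_grouped[OF sol[OF that]] route_grouped
          departure_time_grouped_le[OF assms(1) sol[OF that]] weight_nonneg])
  have "finite ?T"
    by (rule finite_subset[OF _ finite_grouped_solutions]) (auto simp: sol)
  moreover have "?T \<noteq> {}"
    using assms(2) by (auto simp: feasible_instance_def)
  ultimately obtain S where S: "S \<in> ?T" and min: "\<And>S'. S' \<in> ?T \<Longrightarrow> objective I S \<le> objective I S'"
    using arg_min_if_finite(1)[of ?T "objective I"] arg_min_least[of ?T _ "objective I"] by blast
  have "optimal I S"
    unfolding optimal_def using S feas min cost by (blast intro: order_trans)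
  moreover have "route_consecutive I S"
    using S route_consecutive_grouped sol by blast
  ultimately show ?thesis by blast
qed

end
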